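(* Let $k\ge2$ be an integer, let $g_0$ be a $k$-monotone density on $(0,\infty)$, let $X_1,X_2,\dots$ be i.i.d. with density $g_0$, and let $\hat g_n$ be the maximum likelihood estimator of $g_0$ over the class of $k$-monotone densities based on $X_1,\dots,X_n$. Let $c>0$. For $j=1,\dots,k-2$, $$\sup_{x\in[c,\infty)}|\hat g_n^{(j)}(x)-g_0^{(j)}(x)|\to0\quad\text{almost surely as }n\to\infty,$$ and for each $x>0$ at which $g_0$ is $(k-1)$-times differentiable, $$\hat g_n^{(k-1)}(x)\to g_0^{(k-1)}(x)\quad\text{almost surely as }n\to\infty.$$
   Context: For $k\ge2$, a function $g$ on $(0,\infty)$ is $k$-monotone if $(-1)^l g^{(l)}$ is nonnegative, nonincreasing and convex for $l=0,\dots,k-2$; $\mathcal D_k$ is the class of $k$-monotone probability densities on $(0,\infty)$. The MLE $\hat g_n$ maximizes $n^{-1}\sum_{i=1}^n\log g(X_i)$ over $g\in\mathcal D_k$. The estimator is a spline of degree $k-1$, so at its knots $\hat g_n^{(k-1)}$ is understood as a one-sided derivative (left or right). *)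

theory Defs
  imports "HOL-Probability.Probability"
begin

text \<open>
  Functions on the open half-line are total functions on the reals whose values outside
  \<open>{0<..}\<close> are irrelevant. The \<open>l\<close>-th derivative is \<open>(deriv ^^ l) g\<close>; its existence on
  \<open>{0<..}\<close> for \<open>l \<le> k - 2\<close> is the first conjunct below.
\<close>

definition k_monotone :: "nat \<Rightarrow> (real \<Rightarrow> real) \<Rightarrow> bool" where
  "k_monotone k g \<longleftrightarrow>
     (\<forall>l<k - 2. \<forall>x>0. (deriv ^^ l) g differentiable (at x)) \<and>
     (\<forall>l\<le>k - 2.
        (\<forall>x>0. 0 \<le> (- 1) ^ l * (deriv ^^ l) g x) \<and>
        antimono_on {0<..} (\<lambda>x. (- 1) ^ l * (deriv ^^ l) g x) \<and>
        convex_on {0<..} (\<lambda>x. (- 1) ^ l * (deriv ^^ l) g x))"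

definition k_monotone_densities :: "nat \<Rightarrow> (real \<Rightarrow> real) set" where
  "k_monotone_densities k =
     {g. k_monotone k g \<and> (\<integral>\<^sup>+x\<in>{0<..}. ennreal (g x) \<partial>lborel) = 1}"

text \<open>
  The library has \<open>ln 0 = 0\<close>; the likelihood needs \<open>log 0 = - \<infinity>\<close>.
\<close>

definition eln :: "real \<Rightarrow> ereal" where
  "eln y = (if 0 < y then ereal (ln y) else - \<infinity>)"

definition log_likelihood :: "nat \<Rightarrow> (nat \<Rightarrow> real) \<Rightarrow> (real \<Rightarrow> real) \<Rightarrow> ereal" where
  "log_likelihood n xs g = ereal (1 / real n) * (\<Sum>i<n. eln (g (xs i)))"

definition is_MLE :: "nat \<Rightarrow> nat \<Rightarrow> (nat \<Rightarrow> real) \<Rightarrow> (real \<Rightarrow> real) \<Rightarrow> bool" where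
  "is_MLE k n xs g \<longleftrightarrow>
     g \<in> k_monotone_densities k \<and>
     (\<forall>h\<in>k_monotone_densities k. log_likelihood n xs h \<le> log_likelihood n xs g)"

end

theory Submission
  imports Defs
begin

text \<open>
  All that is asked about derivatives follows from pointwise convergence \<open>ghat n x \<longlonglongrightarrow> g0 x\<close> for every
  \<open>x > 0\<close>. The signed derivatives \<open>(-1) ^ l * g^(l)\<close> with \<open>l \<le> k - 2\<close> are convex; and when convex functions
  converge pointwise, their subgradients at \<open>x\<close> converge to the derivative of the limit wherever that
  derivative exists (\<open>subgradients_converge\<close>). Applied order by order, this gives pointwise convergence
  of the derivatives up to order \<open>k - 2\<close>, and at the last step that of the two one-sided derivatives of
  order \<open>k - 1\<close>. The convergence is uniform on \<open>{c..}\<close> because the signed derivatives are decreasing and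
  their limits are continuous and vanish at infinity (\<open>antimono_pointwise_imp_uniform\<close>).

  Pointwise consistency rests on the convexity of the class of densities: moving from the maximizer
  \<open>g = ghat n\<close> towards \<open>g0\<close> cannot increase the likelihood, so the average of \<open>g0 / g\<close> over the sample is
  at most \<open>1\<close> (\<open>MLE_ratio_sum_le\<close>). If the sample average could be replaced by the expectation under
  \<open>g0\<close>, this would read \<open>\<integral> g0\<^sup>2 / g \<le> 1\<close>, and then \<open>\<integral> (g0 - g)\<^sup>2 / g \<le> 1 - 2 + 1 = 0\<close> would force
  \<open>g = g0\<close>. Monotonicity of both densities makes this replacement elementary: on each cell of a grid, \<open>g0 / g\<close>
  is bounded below through values at the end points, so the law of large numbers is needed only for the
  counts in countably many intervals with rational end points. The outcome is an upper bound for a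
  Riemann sum of \<open>x * (g0 x - g x)\<^sup>2\<close>, at most twice \<open>(g0 x - g x)\<^sup>2 / g x\<close> because \<open>x * g x \<le> 2\<close>; the bound is
  arbitrarily small for a suitable grid and all large \<open>n\<close> (\<open>MLE_grid_inequality\<close>). Hence in every window \<open>g\<close> eventually comes
  close to \<open>g0\<close> somewhere, and monotonicity together with continuity of \<open>g0\<close> turns this into convergence
  at every point (\<open>MLE_pointwise_consistent\<close>).
\<close>

section \<open>Convex and monotone functions on the half-line\<close>

text \<open>
  Subgradients on the half-line, the only domain on which the functions here are convex.
\<close>

definition is_subgradient :: "(real \<Rightarrow> real) \<Rightarrow> real \<Rightarrow> real \<Rightarrow> bool" where
  "is_subgradient f x d \<longleftrightarrow> (\<forall>y>0. f x + d * (y - x) \<le> f y)"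

lemma is_subgradientI_slopes:
  assumes "\<And>y. x < y \<Longrightarrow> d \<le> (f y - f x) / (y - x)"
    and "\<And>y. \<lbrakk>0 < y; y < x\<rbrakk> \<Longrightarrow> (f y - f x) / (y - x) \<le> d"
  shows "is_subgradient f x d"
  unfolding is_subgradient_def
proof (intro allI impI)
  fix y :: real assume "0 < y"
  consider "y < x" | "y = x" | "x < y" by linarith
  then show "f x + d * (y - x) \<le> f y"
  proof cases
    case 1
    with assms(2)[of y] \<open>0 < y\<close> have "d * (y - x) \<le> f y - f x"
      by (simp add: neg_divide_le_eq)
    then show ?thesis by simp
  next
    case 3
    with assms(1)[of y] have "d * (y - x) \<le> f y - f x" by (simp add: pos_le_divide_eq)
    then show ?thesis by simp
  qed simp
qed

text \<open>
  The three-slope inequality \<open>convex_on_slope_le\<close> for ordered points becomes monotonicity of the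
  difference quotient, whichever side of \<open>x\<close> the points are on.
\<close>

lemma convex_slopes_mono:
  fixes f :: "real \<Rightarrow> real"
  assumes "convex_on I f" "y \<in> I" "z \<in> I" "x \<in> I" "y < z" "y \<noteq> x" "z \<noteq> x"
  shows "(f y - f x) / (y - x) \<le> (f z - f x) / (z - x)"
proof -
  have swap: "(f a - f b) / (a - b) = (f b - f a) / (b - a)" for a b
    by (simp add: divide_simps) (simp add: algebra_simps)
  consider "x < y" | "z < x" | "y < x" "x < z" using assms by linarith
  then show ?thesis
  proof cases
    case 1
    show ?thesis
      using convex_on_slope_le(1)[OF assms(1) assms(4) assms(3) 1 assms(5)] swap[of x y] swap[of x z]
      by simp
  next
    case 2
    show ?thesis
      using convex_on_slope_le(2)[OF assms(1) assms(2) assms(4) assms(5) 2] by simp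
  next
    case 3
    show ?thesis
      using convex_on_slope_le[OF assms(1) assms(2) assms(3) 3] swap[of x z] by linarith
  qed
qed

text \<open>
  The difference quotients at \<open>x\<close> increase, so from the right they converge to their infimum. That
  infimum lies above every slope from the left, which makes it a subgradient.
\<close>

lemma convex_right_derivative:
  fixes f :: "real \<Rightarrow> real"
  assumes cvx: "convex_on {0<..} f" and x: "0 < x"
  obtains d where "(f has_real_derivative d) (at_right x)" "is_subgradient f x d"
proof -
  define q where "q y = (f y - f x) / (y - x)" for y
  define d where "d = Inf (q ` ({x<..} \<inter> UNIV))"
  have mono: "q y \<le> q z" if "0 < y" "y \<noteq> x" "z \<noteq> x" "y \<le> z" for y z
    using convex_slopes_mono[OF cvx, of y z x] that x unfolding q_def by (cases "y = z") auto
  have lim: "(q \<longlongrightarrow> d) (at x within ({x<..} \<inter> UNIV))"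
    unfolding d_def
  proof (rule Lim_right_bound)
    show "q (x/2) \<le> q a" if "x < a" for a using mono[of "x/2" a] x that by auto
  qed (use mono x in auto)
  have bdd: "bdd_below (q ` ({x<..} \<inter> UNIV))"
    by (rule bdd_belowI2[where m = "q (x/2)"]) (use mono x in auto)
  show thesis
  proof (rule that)
    show "(f has_real_derivative d) (at_right x)"
      using lim unfolding has_field_derivative_iff q_def by simp
    show "is_subgradient f x d"
    proof (rule is_subgradientI_slopes)
      fix y assume "x < y"
      then show "d \<le> (f y - f x) / (y - x)"
        unfolding d_def using cInf_lower[OF _ bdd, of "q y"] by (auto simp: q_def)
    next
      fix y assume y: "0 < y" "y < x"
      have "q y \<le> d" unfolding d_def
        by (rule cInf_greatest) (use y x mono in auto)
      then show "(f y - f x) / (y - x) \<le> d" by (simp add: q_def)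
    qed
  qed
qed

lemma convex_left_derivative:
  fixes f :: "real \<Rightarrow> real"
  assumes cvx: "convex_on {0<..} f" and x: "0 < x"
  obtains d where "(f has_real_derivative d) (at_left x)" "is_subgradient f x d"
proof -
  define q where "q y = (f y - f x) / (y - x)" for y
  define d where "d = Sup (q ` ({..<x} \<inter> {0<..}))"
  have mono: "q y \<le> q z" if "0 < y" "y \<noteq> x" "z \<noteq> x" "y \<le> z" for y z
    using convex_slopes_mono[OF cvx, of y z x] that x unfolding q_def by (cases "y = z") auto
  have lim: "(q \<longlongrightarrow> d) (at x within ({..<x} \<inter> {0<..}))"
    unfolding d_def
  proof (rule Lim_left_bound)
    show "q b \<le> q (x + 1)" if "b \<in> {0<..}" "b < x" for b
      using mono[of b "x + 1"] that by auto
  qed (use mono in auto)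
  have eq: "at x within ({..<x} \<inter> {0<..}) = at_left x"
    by (rule at_within_nhd[of _ "{0<..}"]) (use x in auto)
  have bdd: "bdd_above (q ` ({..<x} \<inter> {0<..}))"
    by (rule bdd_aboveI2[where M = "q (x+1)"]) (use mono x in auto)
  show thesis
  proof (rule that)
    show "(f has_real_derivative d) (at_left x)"
      using lim unfolding has_field_derivative_iff q_def eq by simp
    show "is_subgradient f x d"
    proof (rule is_subgradientI_slopes)
      fix y assume y: "0 < y" "y < x"
      then show "(f y - f x) / (y - x) \<le> d"
        unfolding d_def using cSup_upper[OF _ bdd, of "q y"] by (auto simp: q_def)
    next
      fix y assume y: "x < y"
      have "x/2 \<in> {..<x} \<inter> {0<..}" using x by auto
      then have "q ` ({..<x} \<inter> {0<..}) \<noteq> {}" by blast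
      then have "d \<le> q y" unfolding d_def
        by (rule cSup_least) (use y x mono in auto)
      then show "d \<le> (f y - f x) / (y - x)" by (simp add: q_def)
    qed
  qed
qed

text \<open>
  Derivatives, one-sided derivatives and all other subgradients of a convex function at \<open>x\<close> are
  squeezed between its slopes to the left and to the right. For fixed step these slopes converge with
  the functions, and for a small step the limiting slopes are close to \<open>D\<close>. This is the only way in
  which convergence of derivatives is obtained below.
\<close>

lemma subgradients_converge:
  fixes f :: "real \<Rightarrow> real" and F :: "nat \<Rightarrow> real \<Rightarrow> real"
  assumes conv: "\<And>y. 0 < y \<Longrightarrow> (\<lambda>n. F n y) \<longlonglongrightarrow> f y"
    and x: "0 < x" and der: "(f has_real_derivative D) (at x)"
    and sub: "\<forall>\<^sub>F n in sequentially. is_subgradient (F n) x (d n)"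
  shows "d \<longlonglongrightarrow> D"
proof (rule tendstoI)
  fix e :: real assume "0 < e"
  have "((\<lambda>h. (f (x + h) - f x) / h) \<longlongrightarrow> D) (at 0)"
    using der by (simp add: DERIV_def)
  then obtain r where r: "r > 0"
    "\<And>h. h \<noteq> 0 \<Longrightarrow> \<bar>h\<bar> < r \<Longrightarrow> \<bar>(f (x + h) - f x) / h - D\<bar> < e"
    using LIM_D[OF _ \<open>0 < e\<close>, of "\<lambda>h. (f (x + h) - f x) / h" D 0] by auto
  define h where "h = min r x / 2"
  have h: "0 < h" "h < r" "h < x" using r(1) x unfolding h_def by auto
  have up: "f (x + h) - f x < (D + e) * h"
    using r(2)[of h] h by (simp add: abs_less_iff field_simps)
  have lo: "f (x - h) - f x < (D - e) * (- h)"
    using r(2)[of "-h"] h by (simp add: abs_less_iff field_simps)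
  have "(\<lambda>n. F n (x + h) - F n x) \<longlonglongrightarrow> f (x + h) - f x"
    by (intro tendsto_intros conv) (use h x in auto)
  from order_tendstoD(2)[OF this up]
  have e1: "\<forall>\<^sub>F n in sequentially. F n (x + h) - F n x < (D + e) * h" .
  have "(\<lambda>n. F n (x - h) - F n x) \<longlonglongrightarrow> f (x - h) - f x"
    by (intro tendsto_intros conv) (use h x in auto)
  from order_tendstoD(2)[OF this lo]
  have e2: "\<forall>\<^sub>F n in sequentially. F n (x - h) - F n x < (D - e) * (- h)" .
  show "\<forall>\<^sub>F n in sequentially. dist (d n) D < e"
    using e1 e2 sub
  proof eventually_elim
    case (elim n)
    have "F n x + d n * h \<le> F n (x + h)" "F n x + d n * (- h) \<le> F n (x - h)"
      using elim(3) h x unfolding is_subgradient_def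
      by (auto dest: spec[of _ "x + h"] spec[of _ "x - h"])
    with elim have "d n * h < (D + e) * h" "(D - e) * h < d n * h" by auto
    with h(1) have "d n < D + e" "D - e < d n" by auto
    then show ?case by (simp add: dist_real_def abs_less_iff)
  qed
qed

text \<open>
  Polya's argument: monotone functions are controlled between the points of a finite grid by
  their values on the grid, and the limit varies little between neighbouring grid points; beyond the
  last grid point everything is caught between \<open>0\<close> and a small value.
\<close>

lemma antimono_pointwise_imp_uniform:
  fixes f :: "real \<Rightarrow> real" and F :: "nat \<Rightarrow> real \<Rightarrow> real"
  assumes conv: "\<And>y. c \<le> y \<Longrightarrow> (\<lambda>n. F n y) \<longlonglongrightarrow> f y"
    and F_anti: "\<forall>\<^sub>F n in sequentially. antimono_on {c..} (F n)"
    and F_nonneg: "\<forall>\<^sub>F n in sequentially. \<forall>y\<ge>c. 0 \<le> F n y"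
    and f_anti: "antimono_on {c..} f"
    and f_cont: "continuous_on {c..} f"
    and f_lim: "(f \<longlongrightarrow> 0) at_top"
    and e: "0 < e"
  shows "\<forall>\<^sub>F n in sequentially. \<forall>x\<ge>c. \<bar>F n x - f x\<bar> \<le> e"
proof -
  have f_nonneg: "0 \<le> f y" if "c \<le> y" for y
  proof -
    have "\<forall>\<^sub>F n in sequentially. 0 \<le> F n y" using F_nonneg by eventually_elim (use that in auto)
    then show ?thesis using tendsto_lowerbound[OF conv[OF that]] by simp
  qed
  obtain b0 where b0: "\<And>y. b0 \<le> y \<Longrightarrow> f y < e / 2"
    using order_tendstoD(2)[OF f_lim, of "e/2"] e unfolding eventually_at_top_linorder by auto
  define b where "b = max b0 (c + 1)"
  have "uniformly_continuous_on {c..b} f"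
    by (rule compact_uniformly_continuous) (auto intro: continuous_on_subset[OF f_cont])
  then obtain r where r: "r > 0"
    "\<And>y z. y \<in> {c..b} \<Longrightarrow> z \<in> {c..b} \<Longrightarrow> dist z y < r \<Longrightarrow> dist (f z) (f y) < e / 2"
    using e unfolding uniformly_continuous_on_def by (meson half_gt_zero)
  obtain m :: nat where m: "(b - c) / r < real m" using reals_Archimedean2 by blast
  have bc: "c < b" unfolding b_def by auto
  have m0: "0 < real m" using m bc r(1) by (meson diff_gt_0_iff_gt divide_pos_pos less_trans)
  define w where "w = (b - c) / m"
  have w: "0 < w" "w < r" "m * w = b - c"
    using bc m m0 r(1) unfolding w_def by (auto simp: field_simps)
  define t where "t i = c + real i * w" for i
  have t_ge: "c \<le> t i" for i using w unfolding t_def by auto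
  have t_m: "t m = b" using w unfolding t_def by auto
  have t_le: "t i \<le> b" if "i \<le> m" for i
    using that w mult_right_mono[of "real i" "real m" w] unfolding t_def by linarith
  have "\<forall>\<^sub>F n in sequentially. \<forall>i\<in>{..m}. \<bar>F n (t i) - f (t i)\<bar> < e / 2"
  proof (rule eventually_ball_finite, simp, rule ballI)
    fix i
    show "\<forall>\<^sub>F n in sequentially. \<bar>F n (t i) - f (t i)\<bar> < e / 2"
      using tendstoD[OF conv[OF t_ge[of i]], of "e / 2"] e by (simp add: dist_real_def)
  qed
  then show ?thesis using F_anti F_nonneg
  proof eventually_elim
    case (elim n)
    have close: "F n (t i) < f (t i) + e / 2" "f (t i) - e / 2 < F n (t i)" if "i \<le> m" for i
    proof -
      have "\<bar>F n (t i) - f (t i)\<bar> < e / 2" using elim(1) that by blast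
      then show "F n (t i) < f (t i) + e / 2" "f (t i) - e / 2 < F n (t i)" by linarith+
    qed
    have An: "F n z \<le> F n y" if "c \<le> y" "y \<le> z" for y z
      using elim(2) that by (auto simp: monotone_on_def)
    have Af: "f z \<le> f y" if "c \<le> y" "y \<le> z" for y z
      using f_anti that by (auto simp: monotone_on_def)
    show ?case
    proof (intro allI impI)
      fix x assume x: "c \<le> x"
      show "\<bar>F n x - f x\<bar> \<le> e"
      proof (cases "b \<le> x")
        case True
        have "F n x \<le> F n (t m)" using An[OF t_ge[of m], of x] t_m True by simp
        moreover have "F n (t m) < f (t m) + e / 2" using close(1) by simp
        moreover have "f (t m) < e / 2" "f x < e / 2" using b0 True t_m unfolding b_def by auto
        ultimately show ?thesis using f_nonneg[OF x] elim(3) x by (auto simp: abs_le_iff)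
      next
        case False
        define i where "i = nat \<lfloor>(x - c) / w\<rfloor>"
        have "0 \<le> (x - c) / w" using x w by auto
        then have "real i \<le> (x - c) / w" "(x - c) / w < real i + 1"
          unfolding i_def by linarith+
        then have i: "t i \<le> x" "x < t (Suc i)"
          using w(1) unfolding t_def by (auto simp: field_simps)
        have "real i * w < real m * w" using i(1) False w(3) unfolding t_def by auto
        then have im: "i < m" using w(1) by auto
        have "dist (f (t i)) (f (t (Suc i))) < e / 2"
        proof (rule r(2))
          show "t (Suc i) \<in> {c..b}" "t i \<in> {c..b}" using t_ge t_le im by auto
          show "dist (t i) (t (Suc i)) < r"
            using w(1,2) by (simp add: dist_real_def t_def distrib_right)
        qed
        then have "f (t i) < f (t (Suc i)) + e / 2" unfolding dist_real_def by linarith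
        moreover have "f x \<le> f (t i)" "f (t (Suc i)) \<le> f x"
          using Af i x t_ge by auto
        moreover have "F n x \<le> F n (t i)" "F n (t (Suc i)) \<le> F n x"
          using An i x t_ge by auto
        moreover have "F n (t i) < f (t i) + e/2" using close(1) im by simp
        moreover have "F n (t (Suc i)) > f (t (Suc i)) - e/2" using close(2) im by simp
        ultimately show ?thesis by (auto simp: abs_le_iff)
      qed
    qed
  qed
qed

section \<open>Signed derivatives of k-monotone functions\<close>

text \<open>
  The sign makes each of these functions nonnegative, decreasing and convex when \<open>g\<close> is
  \<open>k\<close>-monotone and \<open>l \<le> k - 2\<close>, so that one argument about convex functions serves every order.
\<close>

definition signed_deriv :: "nat \<Rightarrow> (real \<Rightarrow> real) \<Rightarrow> real \<Rightarrow> real" where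
  "signed_deriv l g x = (- 1) ^ l * (deriv ^^ l) g x"

lemma k_monotoneD:
  assumes "k_monotone k g" "l \<le> k - 2"
  shows "\<And>x. 0 < x \<Longrightarrow> 0 \<le> signed_deriv l g x"
    and "antimono_on {0<..} (signed_deriv l g)"
    and "convex_on {0<..} (signed_deriv l g)"
  using assms unfolding k_monotone_def signed_deriv_def[abs_def] by blast+

lemma k_monotone_0:
  assumes "k_monotone k g"
  shows "\<And>x. 0 < x \<Longrightarrow> 0 \<le> g x" and "\<And>x y. 0 < x \<Longrightarrow> x \<le> y \<Longrightarrow> g y \<le> g x"
    and "convex_on {0<..} g" and "continuous_on {0<..} g"
proof -
  have eq: "signed_deriv 0 g = g" by (simp add: signed_deriv_def fun_eq_iff)
  show "\<And>x. 0 < x \<Longrightarrow> 0 \<le> g x" using k_monotoneD(1)[OF assms, of 0] eq by simp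
  show "\<And>x y. 0 < x \<Longrightarrow> x \<le> y \<Longrightarrow> g y \<le> g x"
    using k_monotoneD(2)[OF assms, of 0] eq by (auto simp: monotone_on_def)
  show "convex_on {0<..} g" using k_monotoneD(3)[OF assms, of 0] eq by simp
  then show "continuous_on {0<..} g" by (intro convex_on_continuous) auto
qed

lemma signed_deriv_has_derivative:
  assumes "k_monotone k g" "l < k - 2" "0 < x"
  shows "(signed_deriv l g has_real_derivative - signed_deriv (Suc l) g x) (at x)"
proof -
  have "(deriv ^^ l) g differentiable (at x)" using assms unfolding k_monotone_def by blast
  then have "((deriv ^^ l) g has_real_derivative (deriv ^^ Suc l) g x) (at x)"
    by (simp add: DERIV_deriv_iff_real_differentiable)
  from DERIV_cmult[OF this, of "(- 1) ^ l"] show ?thesis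
    unfolding signed_deriv_def by simp
qed

text \<open>
  Induction on the order: a derivative is a subgradient of the convex function one order below.
\<close>

lemma k_monotone_signed_derivs_converge:
  assumes "\<forall>\<^sub>F n in sequentially. k_monotone k (F n)" "k_monotone k g"
    and conv: "\<And>y. 0 < y \<Longrightarrow> (\<lambda>n. F n y) \<longlonglongrightarrow> g y"
    and "l \<le> k - 2" "0 < x"
  shows "(\<lambda>n. signed_deriv l (F n) x) \<longlonglongrightarrow> signed_deriv l g x"
  using assms(4,5)
proof (induction l arbitrary: x)
  case 0
  then show ?case using conv by (simp add: signed_deriv_def)
next
  case (Suc l)
  have "(\<lambda>n. - signed_deriv (Suc l) (F n) x) \<longlonglongrightarrow> - signed_deriv (Suc l) g x"
  proof (rule subgradients_converge)
    show "(\<lambda>n. signed_deriv l (F n) y) \<longlonglongrightarrow> signed_deriv l g y" if "0 < y" for y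
      using Suc that by simp
    show "(signed_deriv l g has_real_derivative - signed_deriv (Suc l) g x) (at x)"
      using Suc assms(2) by (intro signed_deriv_has_derivative) auto
    show "\<forall>\<^sub>F n in sequentially. is_subgradient (signed_deriv l (F n)) x (- signed_deriv (Suc l) (F n) x)"
      using assms(1)
    proof eventually_elim
      case (elim n)
      have "convex_on {0<..} (signed_deriv l (F n))" using k_monotoneD(3)[OF elim] Suc.prems by simp
      moreover have "(signed_deriv l (F n) has_real_derivative - signed_deriv (Suc l) (F n) x)
          (at x within {0<..})"
        by (rule has_field_derivative_at_within, rule signed_deriv_has_derivative[OF elim])
           (use Suc.prems in auto)
      ultimately have "signed_deriv l (F n) y - signed_deriv l (F n) x
          \<ge> - signed_deriv (Suc l) (F n) x * (y - x)" if "0 < y" for y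
        using that Suc.prems
          convex_on_imp_above_tangent[of "{0<..}" "signed_deriv l (F n)" x y
            "- signed_deriv (Suc l) (F n) x"]
        by (simp add: interior_open)
      then show ?case unfolding is_subgradient_def
        by (metis add.commute le_diff_eq)
    qed
  qed fact
  then show ?case by (simp add: tendsto_minus_cancel_left)
qed

text \<open>
  By the mean value theorem and monotonicity, the value of the next signed derivative at \<open>x\<close> is at
  most the decrease of the present one over \<open>{x - 1..x}\<close>, hence at most its value at \<open>x - 1\<close>.
\<close>

lemma k_monotone_signed_deriv_at_top:
  assumes "k_monotone k g" and lim: "(g \<longlongrightarrow> 0) at_top" and "l \<le> k - 2"
  shows "(signed_deriv l g \<longlongrightarrow> 0) at_top"
  using assms(3)
proof (induction l)
  case 0
  then show ?case using lim by (simp add: signed_deriv_def)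
next
  case (Suc l)
  have "filterlim (\<lambda>x::real. x - 1) at_top at_top"
    using filterlim_tendsto_add_at_top[OF tendsto_const[of "- 1"] filterlim_ident[of "at_top :: real filter"]]
    by simp
  with Suc have lim': "((\<lambda>x. signed_deriv l g (x - 1)) \<longlongrightarrow> 0) at_top"
    by (intro filterlim_compose[of "signed_deriv l g" _ at_top "\<lambda>x. x - 1"]) auto
  show ?case
  proof (rule tendsto_sandwich[OF _ _ tendsto_const lim'])
    show "\<forall>\<^sub>F x in at_top. 0 \<le> signed_deriv (Suc l) g x"
      using eventually_gt_at_top[of 0]
      by eventually_elim (use k_monotoneD(1)[OF assms(1)] Suc in blast)
    show "\<forall>\<^sub>F x in at_top. signed_deriv (Suc l) g x \<le> signed_deriv l g (x - 1)"
      using eventually_gt_at_top[of 1]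
    proof eventually_elim
      case (elim x)
      have "\<exists>z. x - 1 < z \<and> z < x \<and> signed_deriv l g x - signed_deriv l g (x - 1)
            = (x - (x - 1)) * (- signed_deriv (Suc l) g z)"
        by (rule MVT2) (use elim Suc assms(1) in \<open>auto intro!: signed_deriv_has_derivative\<close>)
      then obtain z where z: "x - 1 < z" "z < x"
        "signed_deriv l g x - signed_deriv l g (x - 1) = - signed_deriv (Suc l) g z" by auto
      have "signed_deriv (Suc l) g x \<le> signed_deriv (Suc l) g z"
        using k_monotoneD(2)[OF assms(1) Suc.prems] z elim by (auto simp: monotone_on_def)
      moreover have "0 \<le> signed_deriv l g x"
        using k_monotoneD(1)[OF assms(1)] Suc.prems elim by auto
      ultimately show ?case using z by linarith
    qed
  qed
qed

text \<open>
  The functions are arbitrary off the half-line, so iterated derivatives are additive only at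
  positive points; openness of the half-line lets the induction go through there.
\<close>

lemma k_monotone_convex_combination:
  assumes f: "k_monotone k f" and g: "k_monotone k g" and ab: "0 \<le> a" "0 \<le> b"
  shows "k_monotone k (\<lambda>x. a * f x + b * g x)"
proof -
  let ?h = "\<lambda>x. a * f x + b * g x"
  have D: "(deriv ^^ l) u differentiable (at x)" if "k_monotone k u" "l < k - 2" "0 < x" for l u x
    using that unfolding k_monotone_def by blast
  have eq: "(deriv ^^ l) ?h x = a * (deriv ^^ l) f x + b * (deriv ^^ l) g x"
    if "l \<le> k - 2" "0 < x" for l x
    using that
  proof (induction l arbitrary: x)
    case (Suc l)
    have "(((\<lambda>x. a * (deriv ^^ l) f x + b * (deriv ^^ l) g x)) has_real_derivative
        a * (deriv ^^ Suc l) f x + b * (deriv ^^ Suc l) g x) (at x)"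
      using D[OF f, of l x] D[OF g, of l x] Suc.prems
      by (auto intro!: DERIV_add DERIV_cmult simp: DERIV_deriv_iff_real_differentiable)
    then have "((deriv ^^ l) ?h has_real_derivative
        a * (deriv ^^ Suc l) f x + b * (deriv ^^ Suc l) g x) (at x)"
      by (rule has_field_derivative_transform_within_open[of _ _ _ "{0<..}"]) (use Suc in auto)
    then show ?case by (simp add: DERIV_imp_deriv)
  qed simp
  have seq: "(- 1) ^ l * (deriv ^^ l) ?h x = a * signed_deriv l f x + b * signed_deriv l g x"
    if "l \<le> k - 2" "0 < x" for l x
    using eq[OF that] by (simp add: signed_deriv_def algebra_simps)
  show ?thesis unfolding k_monotone_def
  proof (intro conjI allI impI)
    fix l x :: "nat" assume "l < k - 2" 
    fix x :: real assume "0 < x"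
    have "(\<lambda>x. a * (deriv ^^ l) f x + b * (deriv ^^ l) g x) differentiable (at x)"
      using D[OF f] D[OF g] \<open>l < k - 2\<close> \<open>0 < x\<close> by (intro derivative_intros) auto
    then show "(deriv ^^ l) ?h differentiable (at x)"
      by (rule differentiable_transform_within[of _ _ _ x])
         (use eq \<open>l < k - 2\<close> \<open>0 < x\<close> in \<open>auto simp: dist_real_def\<close>)
  next
    fix l and x :: real assume "l \<le> k - 2" "0 < x"
    then show "0 \<le> (- 1) ^ l * (deriv ^^ l) ?h x"
      using k_monotoneD(1)[OF f] k_monotoneD(1)[OF g] ab by (subst seq) auto
  next
    fix l assume l: "l \<le> k - 2"
    show "antimono_on {0<..} (\<lambda>x. (- 1) ^ l * (deriv ^^ l) ?h x)"
      using k_monotoneD(2)[OF f l] k_monotoneD(2)[OF g l] ab l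
      by (auto simp: monotone_on_def seq intro!: add_mono mult_left_mono)
    have "convex_on {0<..} (\<lambda>x. a * signed_deriv l f x + b * signed_deriv l g x)"
      using k_monotoneD(3)[OF f l] k_monotoneD(3)[OF g l] ab by (intro convex_on_add convex_on_cmul) auto
    then show "convex_on {0<..} (\<lambda>x. (- 1) ^ l * (deriv ^^ l) ?h x)"
      unfolding convex_on_def
      by (auto simp: seq[OF l] add_nonneg_pos add_pos_nonneg convex_def)
  qed
qed

text \<open>
  At a knot the two one-sided derivatives differ, but both are subgradients of the last convex
  signed derivative, which is all that \<open>subgradients_converge\<close> asks for.
\<close>

lemma k_monotone_one_sided_derivative:
  assumes km: "k_monotone k g" and x: "0 < x" and T: "T = at_left x \<or> T = at_right x"
  shows "is_subgradient (signed_deriv (k - 2) g) x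
      ((- 1) ^ (k - 2) * vector_derivative ((deriv ^^ (k - 2)) g) T)"
proof -
  let ?l = "k - 2"
  note cvx = k_monotoneD(3)[OF km order_refl]
  from T obtain d where d: "(signed_deriv ?l g has_real_derivative d) T"
      "is_subgradient (signed_deriv ?l g) x d"
    using convex_left_derivative[OF cvx x] convex_right_derivative[OF cvx x] by metis
  have T': "\<exists>A. T = at x within A \<and> T \<noteq> bot" using T by auto
  have sq: "(- 1) ^ ?l * (- 1) ^ ?l = (1 :: real)"
    by (simp add: power_add[symmetric])
  have eq: "(\<lambda>y. (- 1) ^ ?l * signed_deriv ?l g y) = (deriv ^^ ?l) g"
    unfolding signed_deriv_def mult.assoc[symmetric] sq by simp
  from T' have "((\<lambda>y. (- 1) ^ ?l * signed_deriv ?l g y) has_real_derivative (- 1) ^ ?l * d) T"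
    using DERIV_cmult d(1) by blast
  then have "((deriv ^^ ?l) g has_vector_derivative (- 1) ^ ?l * d) T"
    unfolding eq by (simp add: has_real_derivative_iff_has_vector_derivative)
  with T' have "vector_derivative ((deriv ^^ ?l) g) T = (- 1) ^ ?l * d"
    using vector_derivative_within by blast
  then have "(- 1) ^ ?l * vector_derivative ((deriv ^^ ?l) g) T = d"
    by (simp add: mult.assoc[symmetric] sq)
  with d(2) show ?thesis by simp
qed

section \<open>Measures with k-monotone densities\<close>

definition half_line_measure :: "(real \<Rightarrow> real) \<Rightarrow> real measure" where
  "half_line_measure g = density lborel (\<lambda>x. ennreal (g x) * indicator {0<..} x)"

lemma sets_half_line_measure [simp]: "sets (half_line_measure g) = sets borel"
  by (simp add: half_line_measure_def)

lemma space_half_line_measure [simp]: "space (half_line_measure g) = UNIV"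
  by (simp add: half_line_measure_def)

lemma k_monotone_measurable:
  assumes "k_monotone k g"
  shows "(\<lambda>x. ennreal (g x) * indicator {0<..} x) \<in> borel_measurable lborel"
proof -
  have "(\<lambda>x. indicator {0<..} x *\<^sub>R g x) \<in> borel_measurable borel"
    using k_monotone_0(4)[OF assms] by (intro borel_measurable_continuous_on_indicator) auto
  then have "(\<lambda>x. ennreal (indicator {0<..} x *\<^sub>R g x)) \<in> borel_measurable borel" by measurable
  also have "(\<lambda>x. ennreal (indicator {0<..} x *\<^sub>R g x)) = (\<lambda>x. ennreal (g x) * indicator {0<..} x)"
    by (auto simp: fun_eq_iff indicator_def)
  finally show ?thesis by simp
qed

lemma prob_space_half_line_measure:
  assumes "g \<in> k_monotone_densities k"
  shows "prob_space (half_line_measure g)"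
proof
  have "k_monotone k g" using assms by (simp add: k_monotone_densities_def)
  then show "emeasure (half_line_measure g) (space (half_line_measure g)) = 1"
    using assms k_monotone_measurable
    by (simp add: half_line_measure_def emeasure_density k_monotone_densities_def)
qed

lemma half_line_measure_interval:
  assumes g: "g \<in> k_monotone_densities k" and "0 < s" "s \<le> t"
  shows "(t - s) * g t \<le> measure (half_line_measure g) {s<..t}"
    and "measure (half_line_measure g) {s<..t} \<le> (t - s) * g s"
proof -
  have km: "k_monotone k g" using g by (simp add: k_monotone_densities_def)
  interpret prob_space "half_line_measure g" by (rule prob_space_half_line_measure[OF g])
  note nn = k_monotone_0(1)[OF km] and anti = k_monotone_0(2)[OF km]
  have eq: "emeasure (half_line_measure g) {s<..t}
      = (\<integral>\<^sup>+x. ennreal (g x) * indicator {0<..} x * indicator {s<..t} x \<partial>lborel)"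
    using k_monotone_measurable[OF km] by (simp add: half_line_measure_def emeasure_density)
  have const: "(\<integral>\<^sup>+x. ennreal c * indicator {s<..t} x \<partial>lborel) = ennreal ((t - s) * c)"
    if "0 \<le> c" for c
    using that assms by (simp add: nn_integral_cmult_indicator ennreal_mult' mult.commute)
  have "ennreal ((t - s) * g t) \<le> emeasure (half_line_measure g) {s<..t}"
    unfolding eq using assms nn[of t]
    by (subst const[symmetric]) (auto intro!: nn_integral_mono ennreal_leI anti simp: indicator_def)
  then show "(t - s) * g t \<le> measure (half_line_measure g) {s<..t}"
    by (simp add: emeasure_eq_measure)
  have "emeasure (half_line_measure g) {s<..t} \<le> ennreal ((t - s) * g s)"
    unfolding eq using assms nn[of s]
    by (subst const[symmetric]) (auto intro!: nn_integral_mono ennreal_leI anti simp: indicator_def)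
  then show "measure (half_line_measure g) {s<..t} \<le> (t - s) * g s"
    using assms nn[of s] by (simp add: emeasure_eq_measure)
qed

text \<open>
  A decreasing density is at least \<open>g t\<close> on \<open>{t/2<..t}\<close>, and this interval has mass at most \<open>1\<close>.
\<close>

lemma k_monotone_density_le:
  assumes g: "g \<in> k_monotone_densities k" and t: "0 < t"
  shows "t * g t \<le> 2"
proof -
  interpret prob_space "half_line_measure g" by (rule prob_space_half_line_measure[OF g])
  have "(t - t/2) * g t \<le> 1"
    using half_line_measure_interval(1)[OF g, of "t/2" t] t prob_le_1[of "{t/2<..t}"] by linarith
  then show ?thesis by (simp add: field_simps)
qed

lemma k_monotone_density_at_top:
  assumes g: "g \<in> k_monotone_densities k"
  shows "(g \<longlongrightarrow> 0) at_top"
proof (rule tendsto_sandwich[OF _ _ tendsto_const])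
  have km: "k_monotone k g" using g by (simp add: k_monotone_densities_def)
  show "\<forall>\<^sub>F x in at_top. 0 \<le> g x"
    using eventually_gt_at_top[of 0] by eventually_elim (use k_monotone_0(1)[OF km] in auto)
  show "\<forall>\<^sub>F x in at_top. g x \<le> 2 / x"
    using eventually_gt_at_top[of 0]
    by eventually_elim (use k_monotone_density_le[OF g] in \<open>auto simp: field_simps\<close>)
  show "((\<lambda>x. 2 / x :: real) \<longlongrightarrow> 0) at_top"
    by (intro tendsto_divide_0[OF tendsto_const] filterlim_at_top_imp_at_infinity filterlim_ident)
qed

lemma half_line_measure_mass_tendsto_1:
  assumes "g \<in> k_monotone_densities k"
  shows "(\<lambda>R. measure (half_line_measure g) {1 / real (Suc R)<..real (Suc R)}) \<longlonglongrightarrow> 1"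
proof -
  interpret prob_space "half_line_measure g" by (rule prob_space_half_line_measure[OF assms])
  let ?A = "\<lambda>R. {1 / real (Suc R)<..real (Suc R)}"
  have Un: "(\<Union>R. ?A R) = {0<..}"
  proof (intro equalityI subsetI)
    fix x :: real assume "x \<in> {0<..}"
    then obtain p q where pq: "inverse (real (Suc p)) < x" "x \<le> real q"
      using reals_Archimedean[of x] real_arch_simple[of x] by auto
    have "1 / real (Suc (max p q)) \<le> inverse (real (Suc p))"
      by (simp add: divide_simps)
    with pq have "x \<in> ?A (max p q)" by auto
    then show "x \<in> (\<Union>R. ?A R)" by blast
  qed (auto intro: less_trans[rotated])
  have "incseq ?A"
  proof (intro incseq_SucI subsetI)
    fix R x assume x: "x \<in> ?A R"
    have "1 / real (Suc (Suc R)) \<le> 1 / real (Suc R)" by (simp add: frac_le)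
    with x show "x \<in> ?A (Suc R)" by auto
  qed
  then have "(\<lambda>R. prob (?A R)) \<longlonglongrightarrow> prob (\<Union>R. ?A R)"
    by (intro finite_Lim_measure_incseq) auto
  moreover have "prob {0<..} = 1"
  proof -
    have km: "k_monotone k g" using assms by (simp add: k_monotone_densities_def)
    have "emeasure (half_line_measure g) {0<..} = (\<integral>\<^sup>+x\<in>{0<..}. ennreal (g x) \<partial>lborel)"
      using k_monotone_measurable[OF km]
      by (auto simp: half_line_measure_def emeasure_density indicator_def intro!: nn_integral_cong)
    then show ?thesis using assms by (simp add: k_monotone_densities_def measure_def)
  qed
  ultimately show ?thesis using Un by simp
qed

lemma k_monotone_densities_convex_combination:
  assumes f: "f \<in> k_monotone_densities k" and g: "g \<in> k_monotone_densities k"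
    and e: "0 \<le> e" "e \<le> 1"
  shows "(\<lambda>x. (1 - e) * f x + e * g x) \<in> k_monotone_densities k"
proof -
  have km: "k_monotone k f" "k_monotone k g"
    and int: "(\<integral>\<^sup>+x\<in>{0<..}. ennreal (f x) \<partial>lborel) = 1" "(\<integral>\<^sup>+x\<in>{0<..}. ennreal (g x) \<partial>lborel) = 1"
    using f g by (auto simp: k_monotone_densities_def)
  note meas[measurable] = k_monotone_measurable[OF km(1)] k_monotone_measurable[OF km(2)]
  have "(\<integral>\<^sup>+x\<in>{0<..}. ennreal ((1 - e) * f x + e * g x) \<partial>lborel)
      = (\<integral>\<^sup>+x. ennreal (1 - e) * (ennreal (f x) * indicator {0<..} x)
            + ennreal e * (ennreal (g x) * indicator {0<..} x) \<partial>lborel)"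
    using k_monotone_0(1)[OF km(1)] k_monotone_0(1)[OF km(2)] e
    by (intro nn_integral_cong) (auto simp: indicator_def ennreal_mult' ennreal_plus)
  also have "\<dots> = ennreal (1 - e) * 1 + ennreal e * 1"
    using int by (subst nn_integral_add) (auto simp: nn_integral_cmult)
  also have "\<dots> = ennreal ((1 - e) + e)" using e by (subst ennreal_plus) auto
  finally show ?thesis
    using k_monotone_convex_combination[OF km, of "1 - e" e] e
    by (simp add: k_monotone_densities_def)
qed

section \<open>Optimality of the maximum likelihood estimator\<close>

lemma log_likelihood_pos:
  assumes "\<And>i. i < n \<Longrightarrow> 0 < h (xs i)"
  shows "log_likelihood n xs h = ereal (1 / real n * (\<Sum>i<n. ln (h (xs i))))"
proof -
  have "(\<Sum>i<n. eln (h (xs i))) = (\<Sum>i<n. ereal (ln (h (xs i))))"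
    using assms by (intro sum.cong) (auto simp: eln_def)
  then show ?thesis by (simp add: log_likelihood_def)
qed

lemma log_likelihood_not_pos:
  assumes "j < n" "\<not> 0 < h (xs j)"
  shows "log_likelihood n xs h = - \<infinity>"
proof -
  have "(\<Sum>i<n. eln (h (xs i))) = eln (h (xs j)) + (\<Sum>i\<in>{..<n} - {j}. eln (h (xs i)))"
    using assms by (subst sum.remove[of _ j]) auto
  moreover have "(\<Sum>i\<in>{..<n} - {j}. eln (h (xs i))) \<noteq> \<infinity>"
    by (auto simp: sum_Pinfty eln_def)
  ultimately have "(\<Sum>i<n. eln (h (xs i))) = - \<infinity>"
    using assms by (auto simp: eln_def)
  then show ?thesis using assms by (simp add: log_likelihood_def)
qed

text \<open>
  A zero at an observation would make the log-likelihood \<open>-\<infinity>\<close>, worse than that of \<open>h\<close>.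
\<close>

lemma MLE_pos_at_sample:
  assumes mle: "is_MLE k n xs g" and h: "h \<in> k_monotone_densities k"
    and pos: "\<And>i. i < n \<Longrightarrow> 0 < h (xs i)" and "i < n"
  shows "0 < g (xs i)"
proof (rule ccontr)
  assume "\<not> 0 < g (xs i)"
  with log_likelihood_not_pos \<open>i < n\<close> have "log_likelihood n xs g = - \<infinity>" by blast
  moreover have "log_likelihood n xs h \<le> log_likelihood n xs g"
    using mle h by (auto simp: is_MLE_def)
  ultimately show False using log_likelihood_pos[of n h xs] pos by simp
qed

text \<open>
  The class of densities is convex, so \<open>(1 - e) g + e h\<close> competes with \<open>g\<close> for \<open>0 \<le> e \<le> 1\<close>. The
  left-hand side minus \<open>n\<close> is the derivative at \<open>e = 0\<close> of \<open>n\<close> times its log-likelihood, which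
  cannot be positive at a maximizer.
\<close>

lemma MLE_ratio_sum_le:
  assumes mle: "is_MLE k n xs g" and h: "h \<in> k_monotone_densities k"
    and pos: "\<And>i. i < n \<Longrightarrow> 0 < h (xs i)"
  shows "(\<Sum>i<n. h (xs i) / g (xs i)) \<le> n"
proof (rule ccontr)
  assume neg: "\<not> ?thesis"
  then have "0 < n" by (cases n) auto
  have gpos: "0 < g (xs i)" if "i < n" for i
    using MLE_pos_at_sample[OF mle h] pos that by blast
  define z where "z i = h (xs i) / g (xs i) - 1" for i
  define \<phi> where "\<phi> e = (\<Sum>i<n. ln ((1 - e) * g (xs i) + e * h (xs i)))" for e
  have gD: "g \<in> k_monotone_densities k" using mle by (simp add: is_MLE_def)
  have "(\<phi> has_real_derivative (\<Sum>i<n. z i)) (at 0)"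
    unfolding \<phi>_def z_def
    by (rule derivative_eq_intros DERIV_sum refl | use gpos in \<open>force simp: field_simps\<close>)+
  moreover have "0 < (\<Sum>i<n. z i)" using neg by (simp add: z_def sum_subtractf)
  ultimately obtain d where d: "0 < d" "\<And>e. 0 < e \<Longrightarrow> e < d \<Longrightarrow> \<phi> 0 < \<phi> (0 + e)"
    using DERIV_pos_inc_right by blast
  define e where "e = min (d/2) 1"
  have e: "0 < e" "e < d" "e \<le> 1" using d(1) unfolding e_def by auto
  let ?h = "\<lambda>x. (1 - e) * g x + e * h x"
  have "0 < ?h (xs i)" if "i < n" for i
    using gpos[OF that] pos[OF that] e by (intro add_nonneg_pos) auto
  then have "log_likelihood n xs ?h = ereal (1 / real n * \<phi> e)"
    by (subst log_likelihood_pos) (auto simp: \<phi>_def)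
  moreover have "log_likelihood n xs g = ereal (1 / real n * \<phi> 0)"
    by (subst log_likelihood_pos) (auto simp: \<phi>_def gpos)
  moreover have "log_likelihood n xs ?h \<le> log_likelihood n xs g"
    using mle k_monotone_densities_convex_combination[OF gD h, of e] e by (auto simp: is_MLE_def)
  ultimately have "\<phi> e \<le> \<phi> 0" using \<open>0 < n\<close> by (simp add: divide_right_mono field_simps)
  with d(2)[OF e(1,2)] show False by simp
qed

section \<open>Squared deviation on a grid\<close>

lemma sum_indicator_consecutive:
  fixes t :: "nat \<Rightarrow> real"
  assumes "mono t"
  shows "(\<Sum>i<m. indicator {t i<..t (Suc i)} x) = (indicator {t 0<..t m} x :: real)"
proof (induction m)
  case (Suc m)
  have "t 0 \<le> t m" "t m \<le> t (Suc m)" using assms by (auto simp: monoD)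
  then have "indicator {t 0<..t m} x + indicator {t m<..t (Suc m)} x
      = (indicator {t 0<..t (Suc m)} x :: real)" by (auto simp: indicator_def)
  then show ?case by (simp only: sum.lessThan_Suc Suc.IH)
qed simp

lemma sum_measure_consecutive:
  fixes t :: "nat \<Rightarrow> real" and M :: "real measure"
  assumes "finite_measure M" "sets M = sets borel" "mono t"
  shows "(\<Sum>i<m. measure M {t i<..t (Suc i)}) = measure M {t 0<..t m}"
proof (induction m)
  interpret finite_measure M by fact
  case (Suc m)
  have "t 0 \<le> t m" "t m \<le> t (Suc m)" using assms by (auto simp: monoD)
  then have "{t 0<..t (Suc m)} = {t 0<..t m} \<union> {t m<..t (Suc m)}" by auto
  then show ?case using assms(2) by (auto simp: Suc.IH intro!: finite_measure_Union[symmetric])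
qed simp

text \<open>
  The heart of the proof: a discrete form of
  \<open>\<integral> (g0 - g)\<^sup>2 / g = \<integral> g0\<^sup>2 / g - 2 \<integral> g0 + \<integral> g \<le> 1 - 2 + 1 = 0\<close>.
  The bound \<open>\<integral> g0\<^sup>2 / g \<le> 1\<close> is what \<open>MLE_ratio_sum_le\<close> says when the empirical measure is replaced by
  \<open>g0\<close>. Since \<open>g0\<close> and \<open>g\<close> decrease, on a cell \<open>{t i<..t (Suc i)}\<close> the ratio \<open>g0 / g\<close> is at least
  \<open>g0 (t (Suc i)) / g (t i)\<close>. So the empirical frequencies of finitely many cells, which do not
  depend on \<open>g\<close>, suffice. The right-hand side collects the error in these frequencies
  (\<open>\<eta>\<close>), the mass of \<open>g0\<close> off the grid, and the cost \<open>w / a\<close> of shifting monotone sums by one cell. The weight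
  \<open>t i\<close> replaces \<open>1 / g (t i)\<close> by means of \<open>k_monotone_density_le\<close>.
\<close>

lemma MLE_grid_inequality:
  fixes a w :: real
  assumes mle: "is_MLE k n xs g" and g0: "g0 \<in> k_monotone_densities k" and n: "1 \<le> n"
    and xs: "\<And>j. j < n \<Longrightarrow> 0 < xs j \<and> 0 < g0 (xs j)"
    and aw: "0 < a" "0 < w" and \<eta>: "0 < \<eta>" "\<eta> < 1"
  defines "t \<equiv> \<lambda>i::nat. a + real i * w"
  assumes emp: "\<And>i. i < m \<Longrightarrow> (1 - \<eta>) * measure (half_line_measure g0) {t i<..t (Suc i)}
        \<le> (\<Sum>j<n. indicator {t i<..t (Suc i)} (xs j)) / n"
  shows "(\<Sum>i<m. w * t i * (g0 (t (Suc i)) - g (t i))\<^sup>2)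
    \<le> 2 * (1 / (1 - \<eta>) + 1 - 2 * measure (half_line_measure g0) {t 0<..t m} + 6 * w / a)"
proof -
  have gD: "g \<in> k_monotone_densities k" using mle by (simp add: is_MLE_def)
  have km: "k_monotone k g" "k_monotone k g0"
    using gD g0 by (auto simp: k_monotone_densities_def)
  interpret P: prob_space "half_line_measure g" by (rule prob_space_half_line_measure[OF gD])
  interpret P0: prob_space "half_line_measure g0" by (rule prob_space_half_line_measure[OF g0])
  define u where "u i = g (t i)" for i
  define v where "v i = g0 (t i)" for i
  define I where "I i = {t i<..t (Suc i)}" for i
  have t_pos: "0 < t i" for i using aw unfolding t_def by (simp add: add_pos_nonneg)
  have t_Suc: "t (Suc i) = t i + w" for i by (simp add: t_def algebra_simps)
  have t_mono: "mono t" using aw by (intro monoI) (simp add: t_def mult_right_mono)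
  have t0: "t 0 = a" by (simp add: t_def)
  have u_nonneg: "0 \<le> u i" and v_nonneg: "0 \<le> v i" for i
    using k_monotone_0(1)[OF km(1)] k_monotone_0(1)[OF km(2)] t_pos by (auto simp: u_def v_def)
  have u_le: "t i * u i \<le> 2" for i
    using k_monotone_density_le[OF gD t_pos] by (simp add: u_def)
  have cell_g: "w * u (Suc i) \<le> measure (half_line_measure g) (I i)" for i
    using half_line_measure_interval(1)[OF gD t_pos, of i "t (Suc i)"] aw
    by (simp add: I_def u_def t_Suc)
  have cell_g0: "w * v (Suc i) \<le> measure (half_line_measure g0) (I i)"
      "measure (half_line_measure g0) (I i) \<le> w * v i" for i
    using half_line_measure_interval[OF g0 t_pos, of i "t (Suc i)"] aw
    by (simp_all add: I_def v_def t_Suc)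
  have gpos: "0 < g (xs j)" if "j < n" for j
    using MLE_pos_at_sample[OF mle g0, of j] xs that by blast
  have cell: "v (Suc i) / u i \<le> g0 (xs j) / g (xs j)" if "j < n" "xs j \<in> I i" for i j
  proof (rule frac_le)
    show "v (Suc i) \<le> g0 (xs j)"
      using that xs k_monotone_0(2)[OF km(2), of "xs j" "t (Suc i)"] by (auto simp: I_def v_def)
    show "g (xs j) \<le> u i"
      using that k_monotone_0(2)[OF km(1) t_pos] by (auto simp: I_def u_def)
  qed (use gpos xs that less_imp_le in auto)
  have "(\<Sum>i<m. (\<Sum>j<n. indicator (I i) (xs j)) * (v (Suc i) / u i))
      = (\<Sum>i<m. \<Sum>j<n. indicator (I i) (xs j) * (v (Suc i) / u i))"
    by (simp only: sum_distrib_right)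
  also have "\<dots> \<le> (\<Sum>i<m. \<Sum>j<n. indicator (I i) (xs j) * (g0 (xs j) / g (xs j)))"
    by (intro sum_mono) (auto simp: indicator_def cell)
  also have "\<dots> = (\<Sum>j<n. (\<Sum>i<m. indicator (I i) (xs j)) * (g0 (xs j) / g (xs j)))"
    by (subst sum.swap) (simp only: sum_distrib_right)
  also have "\<dots> = (\<Sum>j<n. indicator {t 0<..t m} (xs j) * (g0 (xs j) / g (xs j)))"
    unfolding I_def by (simp only: sum_indicator_consecutive[OF t_mono])
  also have "\<dots> \<le> (\<Sum>j<n. g0 (xs j) / g (xs j))"
    using gpos xs by (intro sum_mono) (auto simp: indicator_def intro!: divide_nonneg_pos less_imp_le)
  also have "\<dots> \<le> n" using MLE_ratio_sum_le[OF mle g0] xs by blast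
  finally have "(\<Sum>i<m. (\<Sum>j<n. indicator (I i) (xs j)) * (v (Suc i) / u i)) / n \<le> 1"
    using n by simp
  then have score: "(\<Sum>i<m. (\<Sum>j<n. indicator (I i) (xs j)) / n * (v (Suc i) / u i)) \<le> 1"
    by (simp only: sum_divide_distrib[of _ "{..<m}"] times_divide_eq_left)
  have term_le: "(1 - \<eta>) * (w * v (Suc i) * (v (Suc i) / u i))
      \<le> (\<Sum>j<n. indicator (I i) (xs j)) / n * (v (Suc i) / u i)" if "i < m" for i
  proof -
    have "(1 - \<eta>) * (w * v (Suc i)) \<le> (1 - \<eta>) * measure (half_line_measure g0) (I i)"
      using cell_g0(1) \<eta> by (intro mult_left_mono) auto
    also have "\<dots> \<le> (\<Sum>j<n. indicator (I i) (xs j)) / n" using emp[OF that] by (simp add: I_def)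
    finally have "(1 - \<eta>) * (w * v (Suc i)) \<le> (\<Sum>j<n. indicator (I i) (xs j)) / n" .
    from mult_right_mono[OF this, of "v (Suc i) / u i"] show ?thesis
      using u_nonneg v_nonneg by (simp add: mult.assoc)
  qed
  have "(1 - \<eta>) * (\<Sum>i<m. w * v (Suc i) * (v (Suc i) / u i))
      = (\<Sum>i<m. (1 - \<eta>) * (w * v (Suc i) * (v (Suc i) / u i)))"
    by (rule sum_distrib_left)
  also have "\<dots> \<le> (\<Sum>i<m. (\<Sum>j<n. indicator (I i) (xs j)) / n * (v (Suc i) / u i))"
    by (rule sum_mono) (rule term_le, simp)
  also note score
  finally have "(1 - \<eta>) * (\<Sum>i<m. w * v (Suc i) * (v (Suc i) / u i)) \<le> 1" .
  then have chi: "(\<Sum>i<m. w * v (Suc i) * (v (Suc i) / u i)) \<le> 1 / (1 - \<eta>)"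
    using \<eta> by (simp add: field_simps)
  \<comment> \<open>Division by \<open>u i = 0\<close> yields \<open>0\<close> and would break the square completion below: but a cell of
    positive mass contains an observation, at which \<open>g\<close> is positive.\<close>
  have u0: "v (Suc i) = 0" if "i < m" "u i = 0" for i
  proof (rule ccontr)
    assume "v (Suc i) \<noteq> 0"
    then have "0 < (1 - \<eta>) * (w * v (Suc i))" using v_nonneg[of "Suc i"] aw \<eta> by auto
    also have "\<dots> \<le> (1 - \<eta>) * measure (half_line_measure g0) (I i)"
      using cell_g0(1) \<eta> by (intro mult_left_mono) auto
    also have "\<dots> \<le> (\<Sum>j<n. indicator (I i) (xs j)) / n" using emp[OF that(1)] by (simp add: I_def)
    finally have "(\<Sum>j<n. indicator (I i) (xs j)) \<noteq> (0::real)" by auto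
    then obtain j where j: "j < n" "xs j \<in> I i"
      by (metis (mono_tags, lifting) indicator_simps(2) lessThan_iff sum.neutral)
    then have "g (xs j) \<le> u i"
      using k_monotone_0(2)[OF km(1) t_pos] by (auto simp: I_def u_def)
    with gpos[OF j(1)] that show False by simp
  qed
  have square: "t i * (v (Suc i) - u i)\<^sup>2 / 2 \<le> v (Suc i) * (v (Suc i) / u i) - 2 * v (Suc i) + u i"
    if "i < m" for i
  proof (cases "u i = 0")
    case True
    then show ?thesis using u0[OF that] by simp
  next
    case False
    then have upos: "0 < u i" using u_nonneg[of i] by simp
    have "t i / 2 \<le> 1 / u i" using u_le[of i] upos by (simp add: field_simps)
    then have "t i / 2 * (v (Suc i) - u i)\<^sup>2 \<le> 1 / u i * (v (Suc i) - u i)\<^sup>2"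
      by (rule mult_right_mono) simp
    also have "\<dots> = v (Suc i) * (v (Suc i) / u i) - 2 * v (Suc i) + u i"
      using upos by (simp add: field_simps power2_eq_square)
    finally show ?thesis by simp
  qed
  have tele: "(\<Sum>i<m. f (Suc i)) = (\<Sum>i<m. f i) - f 0 + f m" for f :: "nat \<Rightarrow> real"
    by (induction m) auto
  have "measure (half_line_measure g0) {t 0<..t m} = (\<Sum>i<m. measure (half_line_measure g0) (I i))"
    unfolding I_def by (rule sum_measure_consecutive[OF P0.finite_measure_axioms _ t_mono, symmetric]) simp
  also have "\<dots> \<le> (\<Sum>i<m. w * v i)"
    by (intro sum_mono cell_g0)
  also have "\<dots> \<le> (\<Sum>i<m. w * v (Suc i)) + w * v 0"
    using tele[of "\<lambda>i. w * v i"] v_nonneg[of m] aw by simp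
  finally have v_sum: "measure (half_line_measure g0) {t 0<..t m} \<le> (\<Sum>i<m. w * v (Suc i)) + w * v 0" .
  have "(\<Sum>i<m. w * u i) \<le> w * u 0 + (\<Sum>i<m. w * u (Suc i))"
    using tele[of "\<lambda>i. w * u i"] u_nonneg[of m] aw by simp
  also have "(\<Sum>i<m. w * u (Suc i)) \<le> (\<Sum>i<m. measure (half_line_measure g) (I i))"
    by (intro sum_mono cell_g)
  also have "\<dots> = measure (half_line_measure g) {t 0<..t m}"
    unfolding I_def by (rule sum_measure_consecutive[OF P.finite_measure_axioms _ t_mono]) simp
  also have "\<dots> \<le> 1" by (rule P.prob_le_1)
  finally have u_sum: "(\<Sum>i<m. w * u i) \<le> w * u 0 + 1" by simp
  have start: "w * u 0 \<le> 2 * w / a" "w * v 0 \<le> 2 * w / a"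
    using k_monotone_density_le[OF gD aw(1)] k_monotone_density_le[OF g0 aw(1)] aw
    by (auto simp: u_def v_def t0 field_simps)
  have "(\<Sum>i<m. w * t i * (v (Suc i) - u i)\<^sup>2)
      = 2 * (\<Sum>i<m. w * (t i * (v (Suc i) - u i)\<^sup>2 / 2))"
    by (simp add: sum_distrib_left mult.assoc)
  also have "\<dots> \<le> 2 * (\<Sum>i<m. w * (v (Suc i) * (v (Suc i) / u i) - 2 * v (Suc i) + u i))"
    using square aw by (intro mult_left_mono sum_mono) auto
  also have "(\<Sum>i<m. w * (v (Suc i) * (v (Suc i) / u i) - 2 * v (Suc i) + u i))
      = (\<Sum>i<m. w * v (Suc i) * (v (Suc i) / u i)) - 2 * (\<Sum>i<m. w * v (Suc i)) + (\<Sum>i<m. w * u i)"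
    by (simp add: algebra_simps sum.distrib sum_subtractf sum_distrib_left)
  also have "\<dots> \<le> 1 / (1 - \<eta>) + 1 - 2 * measure (half_line_measure g0) {t 0<..t m} + 6 * w / a"
  proof -
    have "6 * w / a = 3 * (2 * w / a)" by simp
    then show ?thesis using chi v_sum u_sum start by linarith
  qed
  finally show ?thesis unfolding u_def v_def by simp
qed

section \<open>Almost sure convergence of frequencies\<close>

text \<open>
  The strong law of large numbers for indicators: Hoeffding's inequality makes the probabilities
  of a deviation by more than \<open>e\<close> summable, and the Borel-Cantelli lemma applies to a sequence of
  tolerances \<open>e\<close> that tends to \<open>0\<close>.
\<close>

lemma (in prob_space) AE_relative_frequency:
  assumes indep: "indep_vars (\<lambda>_. borel) X UNIV"
    and distr: "\<And>i. distr M borel (X i) = \<mu>"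
    and A [measurable]: "A \<in> sets (borel :: real measure)"
  shows "AE \<omega> in M. (\<lambda>n. (\<Sum>j<n. indicator A (X j \<omega>)) / real n) \<longlonglongrightarrow> measure \<mu> A"
proof -
  have X [measurable]: "X i \<in> borel_measurable M" for i
    using indep by (auto simp: indep_vars_def)
  define Y :: "nat \<Rightarrow> 'a \<Rightarrow> real" where "Y i \<omega> = indicator A (X i \<omega>)" for i \<omega>
  have Y [measurable]: "Y i \<in> borel_measurable M" for i unfolding Y_def by measurable
  have Y_indep: "indep_vars (\<lambda>_. borel) Y I" for I
  proof -
    have "indep_vars (\<lambda>_. borel) (\<lambda>i \<omega>. indicator A (X i \<omega>) :: real) UNIV"
      by (rule indep_vars_compose2[OF indep]) measurable
    then show ?thesis unfolding Y_def[abs_def] by (rule indep_vars_subset) simp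
  qed
  have Y_distr: "distr M borel (Y i) = distr M borel (Y 0)" for i
  proof -
    have "distr M borel (Y i) = distr (distr M borel (X i)) borel (indicator A)" for i
      by (subst distr_distr) (auto simp: Y_def[abs_def] comp_def)
    then show ?thesis by (simp add: distr)
  qed
  have Y_exp: "expectation (Y 0) = measure \<mu> A"
  proof -
    have "expectation (Y 0) = integral\<^sup>L (distr M borel (X 0)) (indicator A)"
      by (subst integral_distr) (auto simp: Y_def[abs_def])
    also have "\<dots> = measure \<mu> A"
      by (simp add: distr) (metis distr space_distr
          Int_absorb2 space_borel top_greatest)
    finally show ?thesis .
  qed
  have dev: "AE \<omega> in M. \<forall>\<^sub>F n in sequentially. \<bar>(\<Sum>j<n. Y j \<omega>) / real n - measure \<mu> A\<bar> < e"
    if e: "0 < e" for e :: real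
  proof -
    define B where "B n = {\<omega>\<in>space M. e \<le> \<bar>(\<Sum>j<n. Y j \<omega>) / real n - measure \<mu> A\<bar>}" for n
    have B [measurable]: "B n \<in> sets M" for n unfolding B_def by measurable
    have bound: "prob (B n) \<le> 2 * exp (- 2 * e\<^sup>2) ^ n" if "0 < n" for n
    proof -
      interpret H: Hoeffding_ineq_iid M "{..<n}" Y "Y 0" 0 1 "expectation (Y 0)"
      proof unfold_locales
        show "indep_vars (\<lambda>_. borel) Y {..<n}" by (rule Y_indep)
        show "distr M borel (Y i) = distr M borel (Y 0)" for i by (rule Y_distr)
        show "AE \<omega> in M. Y 0 \<omega> \<in> {0..1}" by (auto simp: Y_def indicator_def)
      qed auto
      have "prob (B n) \<le> 2 * exp (- 2 * real n * e\<^sup>2)"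
        using H.Hoeffding_ineq_abs_ge'[of e] e that by (auto simp: B_def Y_exp)
      also have "exp (- 2 * real n * e\<^sup>2) = exp (- 2 * e\<^sup>2) ^ n"
        by (simp add: exp_of_nat_mult[symmetric] mult_ac)
      finally show ?thesis .
    qed
    have "summable (\<lambda>n. 2 * exp (- 2 * e\<^sup>2) ^ n)"
      using e by (intro summable_mult summable_geometric) auto
    then have "summable (\<lambda>n. prob (B n))"
      by (rule summable_comparison_test'[where N = 1]) (use bound in auto)
    then have "AE \<omega> in M. \<forall>\<^sub>F n in sequentially. \<omega> \<in> space M - B n"
      by (intro borel_cantelli_AE1) (auto simp: emeasure_eq_measure)
    then show ?thesis
      by eventually_elim (auto elim!: eventually_mono simp: B_def)
  qed
  have "AE \<omega> in M. \<forall>q. \<forall>\<^sub>F n in sequentially.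
      \<bar>(\<Sum>j<n. Y j \<omega>) / real n - measure \<mu> A\<bar> < inverse (real (Suc q))"
    unfolding AE_all_countable by (intro allI dev) simp
  then show ?thesis
  proof eventually_elim
    case (elim \<omega>)
    show ?case
    proof (rule tendstoI)
      fix e :: real assume "0 < e"
      then obtain q where "inverse (real (Suc q)) < e" using reals_Archimedean by blast
      then show "\<forall>\<^sub>F n in sequentially. dist ((\<Sum>j<n. indicator A (X j \<omega>)) / real n) (measure \<mu> A) < e"
        using elim[rule_format, of q] by (auto elim!: eventually_mono simp: Y_def dist_real_def)
    qed
  qed
qed

section \<open>Pointwise consistency\<close>

text \<open>
  If the estimator stayed \<open>\<kappa>\<close> away from \<open>g0\<close> throughout a fixed window, the cells in the window
  alone would make the left-hand side of \<open>MLE_grid_inequality\<close> at least a fixed \<open>2 * e\<close>. The right-hand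
  side is below that once the grid reaches far enough, is fine enough, and \<open>n\<close> is large. The grid
  consists of multiples of \<open>1 / L\<close>, so that countably many cells serve all choices.
\<close>

lemma eventually_MLE_close_on_window:
  fixes xs :: "nat \<Rightarrow> real"
  assumes g0: "g0 \<in> k_monotone_densities k"
    and mle: "\<And>n. 1 \<le> n \<Longrightarrow> is_MLE k n xs (G n)"
    and xs: "\<And>j. 0 < xs j \<and> 0 < g0 (xs j)"
    and freq: "\<And>i L. 0 < L \<Longrightarrow>
      (\<lambda>n. (\<Sum>j<n. indicator {real i / real L<..real (Suc i) / real L} (xs j)) / real n)
        \<longlonglongrightarrow> measure (half_line_measure g0) {real i / real L<..real (Suc i) / real L}"
    and st: "0 < s" "s < t'" and \<kappa>: "0 < \<kappa>"
  shows "\<forall>\<^sub>F n in sequentially. \<exists>y\<in>{s..t'}. \<exists>z\<in>{s..t'}. \<bar>G n y - g0 z\<bar> < \<kappa>"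
proof -
  let ?\<mu> = "half_line_measure g0"
  define e where "e = (t' - s) / 2 * (s * \<kappa>\<^sup>2) / 2"
  have e: "0 < e" using st \<kappa> by (simp add: e_def)
  have "\<forall>\<^sub>F R in sequentially. 1 - e / 8 < measure ?\<mu> {1 / real (Suc R)<..real (Suc R)}"
    using order_tendstoD(1)[OF half_line_measure_mass_tendsto_1[OF g0], of "1 - e/8"] e by simp
  moreover have "\<forall>\<^sub>F R in sequentially. inverse (real (Suc R)) < s"
    using order_tendstoD(2)[OF LIMSEQ_inverse_real_of_nat st(1)] by simp
  moreover have "\<forall>\<^sub>F R in sequentially. t' < real (Suc R)"
    using filterlim_compose[OF filterlim_real_sequentially filterlim_Suc]
    by (auto simp: filterlim_at_top_dense)
  ultimately have "\<forall>\<^sub>F R in sequentially. 1 - e / 8 < measure ?\<mu> {1 / real (Suc R)<..real (Suc R)}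
      \<and> inverse (real (Suc R)) < s \<and> t' < real (Suc R)" by eventually_elim simp
  then obtain R' where R': "1 - e / 8 < measure ?\<mu> {1 / real (Suc R')<..real (Suc R')}"
    "inverse (real (Suc R')) < s" "t' < real (Suc R')"
    using eventually_happens'[OF sequentially_bot] by blast
  define R where "R = Suc R'"
  have R: "1 - e / 8 < measure ?\<mu> {1 / real R<..real R}" "1 / real R < s" "t' < real R" "0 < R"
    using R' by (auto simp: R_def inverse_eq_divide)
  obtain r :: nat where r: "6 * 8 / e + 4 / (t' - s) < real r" using reals_Archimedean2 by blast
  have r0: "0 < real r"
    using e st by (intro le_less_trans[OF _ r] add_nonneg_nonneg) auto
  have r1: "6 / real r \<le> e / 8"
  proof -
    have "6 * 8 / e \<le> real r" using r st by (smt (verit) divide_nonneg_pos)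
    then show ?thesis using e r0 by (simp add: field_simps)
  qed
  have r2: "2 / real r \<le> (t' - s) / 2"
  proof -
    have "4 / (t' - s) \<le> real r" using r e by (smt (verit) divide_nonneg_pos)
    then show ?thesis using st r0 by (simp add: field_simps)
  qed
  \<comment> \<open>This value makes \<open>1 / (1 - \<eta>) = 1 + e / 8\<close>.\<close>
  define \<eta> where "\<eta> = (e / 8) / (1 + e / 8)"
  have \<eta>: "0 < \<eta>" "\<eta> < 1" "1 / (1 - \<eta>) = 1 + e / 8"
    using e by (auto simp: \<eta>_def field_simps)
  define L where "L = R * r"
  define a where "a = 1 / real R"
  define w where "w = 1 / real L"
  \<comment> \<open>The grid of step \<open>1 / L\<close> starts at \<open>r / L = 1 / R\<close>; after \<open>m\<close> steps it ends at \<open>R\<close>.\<close>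
  define m where "m = R * L - r"
  define t where "t i = a + real i * w" for i :: nat
  have L: "0 < L" using R r0 by (simp add: L_def)
  have aw: "0 < a" "0 < w" using R L by (auto simp: a_def w_def)
  have w_le: "w \<le> 1 / real r" using R(4) r0 by (auto simp: w_def L_def field_simps)
  have wa: "w / a = 1 / real r" using R(4) r0 by (simp add: w_def a_def L_def)
  have t_eq: "t i = real (r + i) / real L" for i
    using R(4) r0 by (simp add: t_def a_def w_def L_def field_simps)
  have "r \<le> R * L" using R(4) by (simp add: L_def)
  then have t_m: "t m = real R" using L by (simp add: t_eq m_def)
  have t_0: "t 0 = 1 / real R" by (simp add: t_def a_def)
  have t_Suc: "t (Suc i) = t i + w" for i by (simp add: t_def algebra_simps)
  have ev: "\<forall>\<^sub>F n in sequentially. \<forall>i\<in>{..<m}. (1 - \<eta>) * measure ?\<mu> {t i<..t (Suc i)}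
        \<le> (\<Sum>j<n. indicator {t i<..t (Suc i)} (xs j)) / real n"
  proof (rule eventually_ball_finite, simp, rule ballI)
    fix i
    let ?p = "measure ?\<mu> {t i<..t (Suc i)}"
    show "\<forall>\<^sub>F n in sequentially. (1 - \<eta>) * ?p
        \<le> (\<Sum>j<n. indicator {t i<..t (Suc i)} (xs j)) / real n"
    proof (cases "?p = 0")
      case True
      then show ?thesis by (auto intro!: always_eventually divide_nonneg_nonneg sum_nonneg)
    next
      case False
      then have "0 < ?p" using measure_nonneg[of ?\<mu>] by (simp add: less_le)
      then have "(1 - \<eta>) * ?p < ?p" using \<eta> by simp
      moreover have "(\<lambda>n. (\<Sum>j<n. indicator {t i<..t (Suc i)} (xs j)) / real n) \<longlonglongrightarrow> ?p"
        using freq[OF L, of "r + i"] by (simp add: t_eq)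
      ultimately show ?thesis
        by (auto dest: order_tendstoD(1) elim!: eventually_mono)
    qed
  qed
  \<comment> \<open>The cells with index in \<open>{p..<q}\<close> are those inside the window; at most two cell widths of the
    window are lost by rounding.\<close>
  define p where "p = nat \<lceil>(s - a) / w\<rceil>"
  define q where "q = nat \<lfloor>(t' - a) / w\<rfloor>"
  have as: "0 \<le> (s - a) / w" using R(2) aw by (simp add: a_def)
  have at: "0 \<le> (t' - a) / w" using R(2) aw st by (simp add: a_def)
  have p: "(s - a) / w \<le> real p" "real p \<le> (s - a) / w + 1"
    using as unfolding p_def by linarith+
  have q: "real q \<le> (t' - a) / w" "(t' - a) / w - 1 \<le> real q"
    using at unfolding q_def by linarith+
  have p': "s \<le> t p" using p(1) aw by (simp add: t_def field_simps)
  have q': "t q \<le> t'" using q(1) aw by (simp add: t_def field_simps)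
  have qm: "q \<le> m"
  proof (rule ccontr)
    assume "\<not> q \<le> m"
    then have "t m \<le> t q" using aw by (simp add: t_def mult_right_mono)
    with q' t_m R(3) show False by simp
  qed
  have win: "s \<le> t i" "t (Suc i) \<le> t'" if "i \<in> {p..<q}" for i
  proof -
    have "real p * w \<le> real i * w" "real (Suc i) * w \<le> real q * w"
      using that aw by (intro mult_right_mono; simp)+
    then show "s \<le> t i" "t (Suc i) \<le> t'" using p' q' unfolding t_def by linarith+
  qed
  have count: "(t' - s) / 2 \<le> real (card {p..<q}) * w"
  proof -
    have "real q - real p \<ge> (t' - s) / w - 2"
      using p(2) q(2) by (simp add: diff_divide_distrib)
    then have "((t' - s) / w - 2) * w \<le> real (card {p..<q}) * w"
      using aw by (intro mult_right_mono) auto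
    moreover have "((t' - s) / w - 2) * w = (t' - s) - 2 * w" using aw by (simp add: field_simps)
    ultimately have "(t' - s) - 2 * w \<le> real (card {p..<q}) * w" by simp
    then show ?thesis using w_le r2 by simp
  qed
  show ?thesis using ev eventually_ge_at_top[of 1]
  proof eventually_elim
    case (elim n)
    show ?case
    proof (rule ccontr)
      assume "\<not> ?case"
      then have far: "\<kappa> \<le> \<bar>G n y - g0 z\<bar>" if "y \<in> {s..t'}" "z \<in> {s..t'}" for y z
        using that by force
      have "e * 2 \<le> real (card {p..<q}) * w * (s * \<kappa>\<^sup>2)"
        unfolding e_def using mult_right_mono[OF count, of "s * \<kappa>\<^sup>2"] st by simp
      also have "\<dots> = (\<Sum>i\<in>{p..<q}. w * s * \<kappa>\<^sup>2)" by simp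
      also have "\<dots> \<le> (\<Sum>i\<in>{p..<q}. w * t i * (g0 (t (Suc i)) - G n (t i))\<^sup>2)"
      proof (rule sum_mono)
        fix i assume i: "i \<in> {p..<q}"
        have "\<kappa> \<le> \<bar>g0 (t (Suc i)) - G n (t i)\<bar>"
          using far[of "t i" "t (Suc i)"] win[OF i] t_Suc[of i] aw by (auto simp: abs_minus_commute)
        then have "\<kappa>\<^sup>2 \<le> (g0 (t (Suc i)) - G n (t i))\<^sup>2"
          using \<kappa> by (metis abs_le_square_iff abs_of_pos)
        then show "w * s * \<kappa>\<^sup>2 \<le> w * t i * (g0 (t (Suc i)) - G n (t i))\<^sup>2"
          using win[OF i] aw st by (intro mult_mono) auto
      qed
      also have "\<dots> \<le> (\<Sum>i<m. w * t i * (g0 (t (Suc i)) - G n (t i))\<^sup>2)"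
        using qm aw by (intro sum_mono2) (auto simp: t_def)
      also have "\<dots> \<le> 2 * (1 / (1 - \<eta>) + 1 - 2 * measure ?\<mu> {t 0<..t m} + 6 * w / a)"
        unfolding t_def
        by (rule MLE_grid_inequality[OF mle[OF elim(2)] g0 elim(2)])
           (use xs aw \<eta> elim(1) in \<open>auto simp: t_def\<close>)
      also have "\<dots> = 2 * (2 + e / 8 - 2 * measure ?\<mu> {1 / real R<..real R} + 6 / real r)"
        using wa by (simp add: \<eta>(3) t_m t_0)
      also have "\<dots> < 2 * e" using R(1) r1 e by simp
      finally show False by simp
    qed
  qed
qed

text \<open>
  Closeness somewhere in a short window to the left of \<open>x\<close> bounds the decreasing estimator at \<open>x\<close> from above,
  closeness in a window to the right bounds it from below, and \<open>g0\<close> is continuous.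
\<close>

lemma MLE_pointwise_consistent:
  fixes xs :: "nat \<Rightarrow> real"
  assumes g0: "g0 \<in> k_monotone_densities k"
    and mle: "\<And>n. 1 \<le> n \<Longrightarrow> is_MLE k n xs (G n)"
    and xs: "\<And>j. 0 < xs j \<and> 0 < g0 (xs j)"
    and freq: "\<And>i L. 0 < L \<Longrightarrow>
      (\<lambda>n. (\<Sum>j<n. indicator {real i / real L<..real (Suc i) / real L} (xs j)) / real n)
        \<longlonglongrightarrow> measure (half_line_measure g0) {real i / real L<..real (Suc i) / real L}"
    and x: "0 < x"
  shows "(\<lambda>n. G n x) \<longlonglongrightarrow> g0 x"
proof (rule tendstoI)
  fix e :: real assume e: "0 < e"
  have km0: "k_monotone k g0" using g0 by (simp add: k_monotone_densities_def)
  have "isCont g0 x"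
    using k_monotone_0(4)[OF km0] x by (simp add: continuous_on_eq_continuous_at)
  then obtain d where d: "0 < d" "\<And>y. \<bar>y - x\<bar> < d \<Longrightarrow> \<bar>g0 y - g0 x\<bar> < e / 2"
    using e unfolding continuous_at_eps_delta dist_real_def by (meson half_gt_zero)
  define h where "h = min d x / 2"
  have h: "0 < h" "h < d" "h < x" using d x unfolding h_def by auto
  have near: "g0 (x - h) < g0 x + e / 2" "g0 x - e / 2 < g0 (x + h)"
    using d(2)[of "x - h"] d(2)[of "x + h"] h by (simp_all, linarith+)
  have left: "\<forall>\<^sub>F n in sequentially. \<exists>y\<in>{x - h..x}. \<exists>z\<in>{x - h..x}. \<bar>G n y - g0 z\<bar> < e / 2"
    by (rule eventually_MLE_close_on_window[OF g0 mle xs freq]) (use h e in auto)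
  have right: "\<forall>\<^sub>F n in sequentially. \<exists>y\<in>{x..x + h}. \<exists>z\<in>{x..x + h}. \<bar>G n y - g0 z\<bar> < e / 2"
    by (rule eventually_MLE_close_on_window[OF g0 mle xs freq]) (use h e x in auto)
  show "\<forall>\<^sub>F n in sequentially. dist (G n x) (g0 x) < e"
    using left right eventually_ge_at_top[of 1]
  proof eventually_elim
    case (elim n)
    have km: "k_monotone k (G n)"
      using mle[OF elim(3)] by (simp add: is_MLE_def k_monotone_densities_def)
    obtain y z where yz: "y \<in> {x - h..x}" "z \<in> {x - h..x}" "\<bar>G n y - g0 z\<bar> < e / 2"
      using elim(1) by blast
    have "G n x \<le> G n y" "g0 z \<le> g0 (x - h)"
      using k_monotone_0(2)[OF km, of y x] k_monotone_0(2)[OF km0, of "x - h" z] yz h by auto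
    then have up: "G n x < g0 x + e" using yz(3) near(1) by linarith
    obtain y z where yz: "y \<in> {x..x + h}" "z \<in> {x..x + h}" "\<bar>G n y - g0 z\<bar> < e / 2"
      using elim(2) by blast
    have "G n y \<le> G n x" "g0 (x + h) \<le> g0 z"
      using k_monotone_0(2)[OF km, of x y] k_monotone_0(2)[OF km0, of z "x + h"] yz h x by auto
    then have "g0 x - e < G n x" using yz(3) near(2) by linarith
    with up show ?case by (simp add: dist_real_def abs_less_iff)
  qed
qed

section \<open>Consistency of the derivatives\<close>

lemma SUP_abs_tendsto_0I:
  fixes f :: "nat \<Rightarrow> 'b \<Rightarrow> real"
  assumes "S \<noteq> {}" and "\<And>e. 0 < e \<Longrightarrow> \<forall>\<^sub>F n in sequentially. \<forall>x\<in>S. \<bar>f n x\<bar> \<le> e"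
  shows "(\<lambda>n. SUP x\<in>S. ereal \<bar>f n x\<bar>) \<longlonglongrightarrow> 0"
proof (rule order_tendstoI)
  fix a :: ereal assume "a < 0"
  obtain x where "x \<in> S" using assms(1) by blast
  have "a < (SUP x\<in>S. ereal \<bar>f n x\<bar>)" for n
    by (rule less_le_trans[OF \<open>a < 0\<close>], rule SUP_upper2[OF \<open>x \<in> S\<close>]) simp
  then show "\<forall>\<^sub>F n in sequentially. a < (SUP x\<in>S. ereal \<bar>f n x\<bar>)" by simp
next
  fix a :: ereal assume "0 < a"
  then obtain e where e: "0 < ereal e" "ereal e < a" using ereal_dense2 by blast
  then have "\<forall>\<^sub>F n in sequentially. \<forall>x\<in>S. \<bar>f n x\<bar> \<le> e" using assms(2) by simp
  then show "\<forall>\<^sub>F n in sequentially. (SUP x\<in>S. ereal \<bar>f n x\<bar>) < a"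
  proof eventually_elim
    case (elim n)
    have "(SUP x\<in>S. ereal \<bar>f n x\<bar>) \<le> ereal e" using elim by (intro SUP_least) auto
    then show ?case using e(2) by (rule le_less_trans)
  qed
qed

theorem corollary3p1:
  fixes M :: "'a measure" and X :: "nat \<Rightarrow> 'a \<Rightarrow> real"
    and k :: nat and g0 :: "real \<Rightarrow> real" and c :: real
    and ghat :: "nat \<Rightarrow> 'a \<Rightarrow> real \<Rightarrow> real"
  assumes "prob_space M"
    and "2 \<le> k"
    and "g0 \<in> k_monotone_densities k"
    and "prob_space.indep_vars M (\<lambda>_. borel) X UNIV"
    and "\<And>i. distributed M lborel (X i) (\<lambda>x. ennreal (g0 x) * indicator {0<..} x)"
    and "AE \<omega> in M. \<forall>n\<ge>1. is_MLE k n (\<lambda>i. X i \<omega>) (ghat n \<omega>)"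
    and "0 < c"
  shows "(\<forall>j\<in>{1..k - 2}. AE \<omega> in M.
            (\<lambda>n. SUP x\<in>{c..}. ereal \<bar>(deriv ^^ j) (ghat n \<omega>) x - (deriv ^^ j) g0 x\<bar>)
              \<longlonglongrightarrow> 0) \<and>
         (\<forall>x>0. (deriv ^^ (k - 2)) g0 differentiable (at x) \<longrightarrow>
            (AE \<omega> in M.
              (\<lambda>n. vector_derivative ((deriv ^^ (k - 2)) (ghat n \<omega>)) (at_left x))
                \<longlonglongrightarrow> (deriv ^^ (k - 1)) g0 x \<and>
              (\<lambda>n. vector_derivative ((deriv ^^ (k - 2)) (ghat n \<omega>)) (at_right x))
                \<longlonglongrightarrow> (deriv ^^ (k - 1)) g0 x))"
proof -
  interpret prob_space M by fact
  note g0 = assms(3)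
  have km0: "k_monotone k g0" using g0 by (simp add: k_monotone_densities_def)
  have distr: "distr M borel (X i) = half_line_measure g0" for i
  proof -
    have "distr M borel (X i) = distr M lborel (X i)" by (intro distr_cong) auto
    then show ?thesis
      using distributed_distr_eq_density[OF assms(5)[of i]] by (simp add: half_line_measure_def)
  qed
  have pos: "AE \<omega> in M. \<forall>j. 0 < X j \<omega> \<and> 0 < g0 (X j \<omega>)"
    unfolding AE_all_countable
  proof
    fix j
    have "AE x in half_line_measure g0. 0 < x \<and> 0 < g0 x"
      unfolding half_line_measure_def AE_density[OF k_monotone_measurable[OF km0]]
      by (rule AE_I2) (simp add: indicator_def split: if_splits)
    moreover have "X j \<in> borel_measurable M"
      using distributed_measurable[OF assms(5)[of j]] by simp
    ultimately show "AE \<omega> in M. 0 < X j \<omega> \<and> 0 < g0 (X j \<omega>)"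
      unfolding distr[of j, symmetric] by (rule AE_distrD[rotated])
  qed
  have "AE \<omega> in M. \<forall>i L. (\<lambda>n. (\<Sum>j<n. indicator {real i / real L<..real (Suc i) / real L} (X j \<omega>)) / real n)
        \<longlonglongrightarrow> measure (half_line_measure g0) {real i / real L<..real (Suc i) / real L}"
    unfolding AE_all_countable by (intro allI AE_relative_frequency assms(4) distr) simp
  with pos assms(6) have consistent: "AE \<omega> in M.
      (\<forall>x>0. (\<lambda>n. ghat n \<omega> x) \<longlonglongrightarrow> g0 x) \<and> (\<forall>\<^sub>F n in sequentially. k_monotone k (ghat n \<omega>))"
  proof eventually_elim
    case (elim \<omega>)
    have "(\<lambda>n. ghat n \<omega> x) \<longlonglongrightarrow> g0 x" if "0 < x" for x
      by (rule MLE_pointwise_consistent[OF g0, of "\<lambda>i. X i \<omega>"]) (use elim that in blast)+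
    moreover have "\<forall>\<^sub>F n in sequentially. k_monotone k (ghat n \<omega>)"
      using eventually_ge_at_top[of 1]
      by eventually_elim (use elim(2) in \<open>auto simp: is_MLE_def k_monotone_densities_def\<close>)
    ultimately show ?case by blast
  qed
  show ?thesis
  proof (intro conjI ballI allI impI)
    fix j assume "j \<in> {1..k - 2}"
    then have j: "j \<le> k - 2" by simp
    show "AE \<omega> in M. (\<lambda>n. SUP x\<in>{c..}. ereal \<bar>(deriv ^^ j) (ghat n \<omega>) x - (deriv ^^ j) g0 x\<bar>) \<longlonglongrightarrow> 0"
      using consistent
    proof eventually_elim
      case (elim \<omega>)
      have sub: "{c..} \<subseteq> {0<..}" using assms(7) by auto
      have abs_eq: "\<bar>(deriv ^^ j) (ghat n \<omega>) x - (deriv ^^ j) g0 x\<bar>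
          = \<bar>signed_deriv j (ghat n \<omega>) x - signed_deriv j g0 x\<bar>" for n x
        by (simp add: signed_deriv_def right_diff_distrib[symmetric] abs_mult power_abs)
      have "\<forall>\<^sub>F n in sequentially. \<forall>x\<in>{c..}. \<bar>signed_deriv j (ghat n \<omega>) x - signed_deriv j g0 x\<bar> \<le> e"
        if "0 < e" for e
        unfolding Ball_def atLeast_iff
      proof (rule antimono_pointwise_imp_uniform)
        show "(\<lambda>n. signed_deriv j (ghat n \<omega>) y) \<longlonglongrightarrow> signed_deriv j g0 y" if "c \<le> y" for y
          using elim j that assms(7)
          by (intro k_monotone_signed_derivs_converge[of k "\<lambda>n. ghat n \<omega>"] km0) auto
        show "\<forall>\<^sub>F n in sequentially. antimono_on {c..} (signed_deriv j (ghat n \<omega>))"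
          using conjunct2[OF elim]
          by eventually_elim (use k_monotoneD(2)[OF _ j] monotone_on_subset[OF _ sub] in blast)
        show "\<forall>\<^sub>F n in sequentially. \<forall>y\<ge>c. 0 \<le> signed_deriv j (ghat n \<omega>) y"
          using conjunct2[OF elim]
          by eventually_elim (use k_monotoneD(1)[OF _ j] assms(7) in auto)
        show "antimono_on {c..} (signed_deriv j g0)"
          using k_monotoneD(2)[OF km0 j] sub by (rule monotone_on_subset)
        show "continuous_on {c..} (signed_deriv j g0)"
          using convex_on_continuous[OF _ k_monotoneD(3)[OF km0 j]] sub
          by (auto intro: continuous_on_subset)
        show "(signed_deriv j g0 \<longlongrightarrow> 0) at_top"
          by (rule k_monotone_signed_deriv_at_top[OF km0 k_monotone_density_at_top[OF g0] j])
      qed fact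
      then show ?case unfolding abs_eq by (intro SUP_abs_tendsto_0I) auto
    qed
  next
    fix x :: real assume x: "0 < x" and diff: "(deriv ^^ (k - 2)) g0 differentiable (at x)"
    let ?l = "k - 2"
    have "k - 1 = Suc ?l" using assms(2) by simp
    with diff have "((deriv ^^ ?l) g0 has_real_derivative (deriv ^^ (k - 1)) g0 x) (at x)"
      by (simp add: DERIV_deriv_iff_real_differentiable)
    from DERIV_cmult[OF this, of "(- 1) ^ ?l"]
    have der: "(signed_deriv ?l g0 has_real_derivative (- 1) ^ ?l * (deriv ^^ (k - 1)) g0 x) (at x)"
      by (simp add: signed_deriv_def[abs_def])
    show "AE \<omega> in M.
        (\<lambda>n. vector_derivative ((deriv ^^ ?l) (ghat n \<omega>)) (at_left x)) \<longlonglongrightarrow> (deriv ^^ (k - 1)) g0 x \<and>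
        (\<lambda>n. vector_derivative ((deriv ^^ ?l) (ghat n \<omega>)) (at_right x)) \<longlonglongrightarrow> (deriv ^^ (k - 1)) g0 x"
      using consistent
    proof eventually_elim
      case (elim \<omega>)
      have "(\<lambda>n. vector_derivative ((deriv ^^ ?l) (ghat n \<omega>)) T) \<longlonglongrightarrow> (deriv ^^ (k - 1)) g0 x"
        if T: "T = at_left x \<or> T = at_right x" for T
      proof -
        have "(\<lambda>n. (- 1) ^ ?l * vector_derivative ((deriv ^^ ?l) (ghat n \<omega>)) T)
            \<longlonglongrightarrow> (- 1) ^ ?l * (deriv ^^ (k - 1)) g0 x"
        proof (rule subgradients_converge[OF _ x der])
          show "(\<lambda>n. signed_deriv ?l (ghat n \<omega>) y) \<longlonglongrightarrow> signed_deriv ?l g0 y" if "0 < y" for y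
            using elim that
            by (intro k_monotone_signed_derivs_converge[of k "\<lambda>n. ghat n \<omega>"] km0) auto
          show "\<forall>\<^sub>F n in sequentially. is_subgradient (signed_deriv ?l (ghat n \<omega>)) x
              ((- 1) ^ ?l * vector_derivative ((deriv ^^ ?l) (ghat n \<omega>)) T)"
            using conjunct2[OF elim]
            by eventually_elim (rule k_monotone_one_sided_derivative[OF _ x T])
        qed
        from tendsto_mult_left[OF this, of "(- 1) ^ ?l"] show ?thesis
          by (simp add: mult.assoc[symmetric] power_add[symmetric])
      qed
      then show ?case by blast
    qed
  qed
qed

end
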